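(* Let $b\ge2$ be an integer and let $c>1$ be real. Put $F_{c,b}(m)=m\log_b c-\log_b m$ and $\delta_b(m)=\log_b(1+1/m)$. For every integer $m\ge1$, $$m\in\mathcal S_{c,b}\quad\Longleftrightarrow\quad F_{c,b}(m)\ge0\ \text{ and }\ \{F_{c,b}(m)\}<\delta_b(m).$$ If $c\ge2$, the condition $F_{c,b}(m)\ge0$ is automatic (it holds for every $m\ge1$).
   Context: For an integer $b\ge2$ and real $c>1$, $\mathcal S_{c,b}$ is the set of integers $m\ge1$ for which there is an integer $k\ge0$ with $mb^k\le c^m<(m+1)b^k$. $\{x\}=x-\lfloor x\rfloor$ denotes the fractional part. *)

theory Defs
  imports Complex_Main
begin

definition S :: "real \<Rightarrow> nat \<Rightarrow> nat set" where
  "S c b = {m. m \<ge> 1 \<and>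
     (\<exists>k::nat. real m * real b ^ k \<le> c ^ m \<and> c ^ m < (real m + 1) * real b ^ k)}"

definition F :: "real \<Rightarrow> nat \<Rightarrow> nat \<Rightarrow> real" where
  "F c b m = real m * log (real b) c - log (real b) (real m)"

definition \<delta> :: "nat \<Rightarrow> nat \<Rightarrow> real" where
  "\<delta> b m = log (real b) (1 + 1 / real m)"

end

theory Submission
  imports Defs
begin

text \<open>
  Taking logarithms to base \<open>b\<close> turns the two inequalities that witness \<open>m \<in> S c b\<close> into
  \<open>k \<le> F c b m < k + \<delta> b m\<close>: the number \<open>F c b m\<close> is the logarithm of \<open>c ^ m / m\<close>, and
  \<open>\<delta> b m\<close> is the length of the logarithmic interval from \<open>m\<close> to \<open>m + 1\<close>.  Since
  \<open>1 + 1 / m \<le> 2 \<le> b\<close>, this length is at most \<open>1\<close>, which forces \<open>k\<close> to be the floor of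
  \<open>F c b m\<close>; the distance from \<open>k\<close> is then the fractional part, and a natural number \<open>k\<close>
  is available exactly when \<open>F c b m\<close> is nonnegative.  For \<open>c \<ge> 2\<close> nonnegativity is the
  bound \<open>m \<le> 2 ^ m \<le> c ^ m\<close>.
\<close>

lemma lower_bound_iff_le_F:
  assumes "b \<ge> 2" and "c > 1" and "m \<ge> 1"
  shows "real m * real b ^ k \<le> c ^ m \<longleftrightarrow> real k \<le> F c b m"
proof -
  have "real m * real b ^ k \<le> c ^ m
      \<longleftrightarrow> log (real b) (real m * real b ^ k) \<le> log (real b) (c ^ m)"
    using assms by (subst log_le_cancel_iff) auto
  also have "log (real b) (real m * real b ^ k) = log (real b) (real m) + real k"
    using assms by (simp add: log_mult log_nat_power)
  also have "log (real b) (c ^ m) = real m * log (real b) c"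
    using assms by (simp add: log_nat_power)
  finally show ?thesis
    by (auto simp: F_def)
qed

lemma upper_bound_iff_F_less:
  assumes "b \<ge> 2" and "c > 1" and "m \<ge> 1"
  shows "c ^ m < (real m + 1) * real b ^ k \<longleftrightarrow> F c b m < real k + \<delta> b m"
proof -
  have pos: "1 + 1 / real m > 0"
    by (simp add: add_pos_nonneg)
  have "(real m + 1) * real b ^ k = real m * (1 + 1 / real m) * real b ^ k"
    using assms by (simp add: field_simps)
  also have "log (real b) \<dots> = log (real b) (real m) + \<delta> b m + real k"
    using assms pos by (simp add: log_mult log_nat_power \<delta>_def)
  finally have log_upper:
    "log (real b) ((real m + 1) * real b ^ k) = log (real b) (real m) + \<delta> b m + real k" .
  have "c ^ m < (real m + 1) * real b ^ k
      \<longleftrightarrow> log (real b) (c ^ m) < log (real b) ((real m + 1) * real b ^ k)"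
    using assms by (subst log_less_cancel_iff) auto
  also note log_upper
  also have "log (real b) (c ^ m) = real m * log (real b) c"
    using assms by (simp add: log_nat_power)
  finally show ?thesis
    by (auto simp: F_def)
qed

text \<open>
  Equality occurs for \<open>b = 2\<close> and \<open>m = 1\<close>.  The non-strict bound is enough to determine
  \<open>k\<close> because the interval of length \<open>\<delta> b m\<close> starting at \<open>k\<close> is half-open.
\<close>

lemma \<delta>_le_1:
  assumes "b \<ge> 2" and "m \<ge> 1"
  shows "\<delta> b m \<le> 1"
proof -
  have "1 / real m \<le> 1"
    using assms by simp
  then have "1 + 1 / real m \<le> real b"
    using assms by linarith
  moreover have "1 + 1 / real m > 0"
    by (simp add: add_pos_nonneg)
  ultimately show ?thesis
    using assms by (simp add: \<delta>_def log_le_one_cancel_iff)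
qed

lemma ex_nat_interval_iff_frac_less:
  fixes x d :: real
  assumes "d \<le> 1"
  shows "(\<exists>k::nat. real k \<le> x \<and> x < real k + d) \<longleftrightarrow> x \<ge> 0 \<and> frac x < d"
proof
  assume "\<exists>k::nat. real k \<le> x \<and> x < real k + d"
  then obtain k :: nat where k: "real k \<le> x" "x < real k + d"
    by blast
  have "\<lfloor>x\<rfloor> = int k"
    using k assms by (intro floor_unique) auto
  with k show "x \<ge> 0 \<and> frac x < d"
    by (auto simp: frac_def)
next
  assume "x \<ge> 0 \<and> frac x < d"
  then have "real (nat \<lfloor>x\<rfloor>) \<le> x \<and> x < real (nat \<lfloor>x\<rfloor>) + d"
    by (auto simp: frac_def)
  then show "\<exists>k::nat. real k \<le> x \<and> x < real k + d"
    by blast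
qed

lemma F_nonneg:
  assumes "b \<ge> 2" and "c \<ge> 2" and "m \<ge> 1"
  shows "F c b m \<ge> 0"
proof -
  have "real m \<le> 2 ^ m"
    using of_nat_less_two_power[of m, where ?'a = real] by simp
  also have "\<dots> \<le> c ^ m"
    using assms by (intro power_mono) auto
  finally show ?thesis
    using lower_bound_iff_le_F[of b c m 0] assms by simp
qed

theorem proposition2p1:
  fixes b :: nat and c :: real
  assumes "b \<ge> 2" and "c > 1"
  shows "(\<forall>m\<ge>1. m \<in> S c b \<longleftrightarrow> F c b m \<ge> 0 \<and> frac (F c b m) < \<delta> b m)
    \<and> (c \<ge> 2 \<longrightarrow> (\<forall>m\<ge>1. F c b m \<ge> 0))"
proof (intro conjI allI impI)
  fix m :: nat
  assume m: "m \<ge> 1"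
  have "m \<in> S c b \<longleftrightarrow> (\<exists>k::nat. real k \<le> F c b m \<and> F c b m < real k + \<delta> b m)"
    using m by (simp add: S_def lower_bound_iff_le_F[OF assms m]
        upper_bound_iff_F_less[OF assms m])
  also have "\<dots> \<longleftrightarrow> F c b m \<ge> 0 \<and> frac (F c b m) < \<delta> b m"
    by (rule ex_nat_interval_iff_frac_less[OF \<delta>_le_1[OF assms(1) m]])
  finally show "m \<in> S c b \<longleftrightarrow> F c b m \<ge> 0 \<and> frac (F c b m) < \<delta> b m" .
next
  fix m :: nat
  assume "c \<ge> 2" and "m \<ge> 1"
  then show "F c b m \<ge> 0"
    using F_nonneg assms(1) by blast
qed

end
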